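(* Every randomized online algorithm for All-or-One Paging with cache size $k$ has competitive ratio at least $2H_k-1$, where $H_k=\sum_{i=1}^k1/i$.
   Context: All-or-One Paging with $k$ slots: each request is either general, $(p,\ast)$, satisfied by a configuration holding page $p$ in any slot, or specific, $(p,j)$ with $j\in[k]$, satisfied only if slot $j$ holds $p$. A configuration assigns to each slot one page or nothing; a solution is a sequence of configurations satisfying the requests in order; its cost is the number of retrievals (page $p$ retrieved in slot $s$ at time $t$ if $C_t$ assigns $p$ to $s$ but $C_{t-1}$ does not, or $t=1$). A randomized online algorithm is $c$-competitive if its expected cost is at most $c\cdot\mathrm{OPT}(\sigma)+b$ for every request sequence $\sigma$, with $b$ a constant independent of $\sigma$. *)

theory Defs
  imports "HOL-Probability.Probability"
begin

datatype 'p request = General 'p | Specific 'p nat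

primrec valid_request :: "nat \<Rightarrow> 'p request \<Rightarrow> bool" where
  "valid_request k (General p) \<longleftrightarrow> True"
| "valid_request k (Specific p j) \<longleftrightarrow> j \<in> {1..k}"

definition request_sequence :: "nat \<Rightarrow> 'p request list \<Rightarrow> bool" where
  "request_sequence k \<sigma> \<longleftrightarrow> (\<forall>r \<in> set \<sigma>. valid_request k r)"

text \<open>The slots are \<open>1, \<dots>, k\<close>; the values of a configuration at other
  arguments are irrelevant.\<close>

type_synonym 'p config = "nat \<Rightarrow> 'p option"

primrec satisfies :: "nat \<Rightarrow> 'p config \<Rightarrow> 'p request \<Rightarrow> bool" where
  "satisfies k C (General p) \<longleftrightarrow> (\<exists>s \<in> {1..k}. C s = Some p)"
| "satisfies k C (Specific p j) \<longleftrightarrow> C j = Some p"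

definition is_solution :: "nat \<Rightarrow> 'p request list \<Rightarrow> 'p config list \<Rightarrow> bool" where
  "is_solution k \<sigma> Cs \<longleftrightarrow>
     length Cs = length \<sigma> \<and> (\<forall>t < length \<sigma>. satisfies k (Cs ! t) (\<sigma> ! t))"

text \<open>Time steps are numbered from \<open>0\<close>, so the first configuration is \<open>Cs ! 0\<close>.\<close>

definition retrieved :: "'p config list \<Rightarrow> nat \<Rightarrow> nat \<Rightarrow> 'p \<Rightarrow> bool" where
  "retrieved Cs t s p \<longleftrightarrow>
     (Cs ! t) s = Some p \<and> (t = 0 \<or> (Cs ! (t - 1)) s \<noteq> Some p)"

definition cost :: "nat \<Rightarrow> 'p config list \<Rightarrow> nat" where
  "cost k Cs = card {(t, s, p). t < length Cs \<and> s \<in> {1..k} \<and> retrieved Cs t s p}"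

definition OPT :: "nat \<Rightarrow> 'p request list \<Rightarrow> nat" where
  "OPT k \<sigma> = Inf {cost k Cs | Cs. is_solution k \<sigma> Cs}"

text \<open>A deterministic online algorithm maps the requests seen so far, the current one
  included, to the configuration that serves the current request.\<close>

type_synonym 'p online_alg = "'p request list \<Rightarrow> 'p config"

definition run :: "'p online_alg \<Rightarrow> 'p request list \<Rightarrow> 'p config list" where
  "run A \<sigma> = map (\<lambda>t. A (take (Suc t) \<sigma>)) [0..<length \<sigma>]"

text \<open>A randomized online algorithm is a deterministic one chosen at random according to a
  probability space \<open>M\<close>. As \<open>cost k (run (A \<omega>) \<sigma>) \<le> k * length \<sigma>\<close>, measurability of the cost
  already makes it integrable, so the integral below is the true expectation.\<close>

definition randomized_online_algorithm ::
    "nat \<Rightarrow> 'w measure \<Rightarrow> ('w \<Rightarrow> 'p online_alg) \<Rightarrow> bool" where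
  "randomized_online_algorithm k M A \<longleftrightarrow>
     prob_space M \<and>
     (\<forall>\<sigma>. request_sequence k \<sigma> \<longrightarrow>
        (\<forall>\<omega> \<in> space M. is_solution k \<sigma> (run (A \<omega>) \<sigma>)) \<and>
        (\<lambda>\<omega>. real (cost k (run (A \<omega>) \<sigma>))) \<in> borel_measurable M)"

definition expected_cost ::
    "nat \<Rightarrow> 'w measure \<Rightarrow> ('w \<Rightarrow> 'p online_alg) \<Rightarrow> 'p request list \<Rightarrow> real" where
  "expected_cost k M A \<sigma> = (\<integral>\<omega>. real (cost k (run (A \<omega>) \<sigma>)) \<partial>M)"

definition competitive ::
    "nat \<Rightarrow> 'w measure \<Rightarrow> ('w \<Rightarrow> 'p online_alg) \<Rightarrow> real \<Rightarrow> bool" where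
  "competitive k M A c \<longleftrightarrow>
     (\<exists>b :: real. \<forall>\<sigma>. request_sequence k \<sigma> \<longrightarrow>
        expected_cost k M A \<sigma> \<le> c * real (OPT k \<sigma>) + b)"

text \<open>The ratio is \<open>\<infinity>\<close> if the algorithm is not \<open>c\<close>-competitive for any \<open>c\<close>.\<close>

definition competitive_ratio ::
    "nat \<Rightarrow> 'w measure \<Rightarrow> ('w \<Rightarrow> 'p online_alg) \<Rightarrow> ereal" where
  "competitive_ratio k M A = Inf {ereal c | c. competitive k M A c}"

end

theory Submission
  imports Defs
begin

text \<open>By averaging (Yao's principle), it suffices to bound the expected cost of a deterministic
  algorithm on a random request sequence. Repeating a batch of requests \<open>2 k\<close> times amounts to
  requesting the whole batch at once: either some round causes no retrieval, so that the
  configuration before it already satisfies the entire batch, or the rounds cost \<open>2 k\<close>, which pays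
  for a detour through any configuration. In a phase that starts with page \<open>c j\<close> in slot \<open>j\<close>, a
  page outside the cache is requested in batches together with \<open>(c j, j)\<close> for more and more slots
  \<open>j\<close>, taken in a uniformly random order, until one slot is left. The optimal solution puts the new
  page into this slot and pays 1 per phase. The algorithm pays 1 for the first retrieval of the new
  page; whenever \<open>i\<close> slots are left, the next one holds the new page with probability at least
  \<open>1 / i\<close>, and then both the new page and \<open>c j\<close> have to be retrieved. The total is
  \<open>1 + 2 (1/k + \<dots> + 1/2)\<close>.\<close>

section \<open>Retrievals\<close>

definition changed_slots :: "nat \<Rightarrow> 'p config \<Rightarrow> 'p config \<Rightarrow> nat set" where
  "changed_slots k C D = {s \<in> {1..k}. D s \<noteq> None \<and> D s \<noteq> C s}"

definition retrievals :: "nat \<Rightarrow> 'p config \<Rightarrow> 'p config \<Rightarrow> nat" where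
  "retrievals k C D = card (changed_slots k C D)"

lemma finite_changed_slots [simp]: "finite (changed_slots k C D)"
  by (simp add: changed_slots_def)

lemma retrievals_self [simp]: "retrievals k C C = 0"
  by (simp add: retrievals_def changed_slots_def)

lemma retrievals_le: "retrievals k C D \<le> k"
proof -
  have "card (changed_slots k C D) \<le> card {1..k}"
    by (rule card_mono) (auto simp: changed_slots_def)
  then show ?thesis by (simp add: retrievals_def)
qed

lemma retrievals_triangle: "retrievals k C E \<le> retrievals k C D + retrievals k D E"
proof -
  have "card (changed_slots k C E) \<le> card (changed_slots k C D \<union> changed_slots k D E)"
    by (rule card_mono) (auto simp: changed_slots_def)
  also have "\<dots> \<le> retrievals k C D + retrievals k D E"
    unfolding retrievals_def by (rule card_Un_le)
  finally show ?thesis by (simp add: retrievals_def)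
qed

lemma satisfies_if_no_retrievals:
  assumes "retrievals k C D = 0" "satisfies k D q" "valid_request k q"
  shows "satisfies k C q"
proof -
  have "changed_slots k C D = {}"
    using assms(1) by (simp add: retrievals_def)
  then have same: "C s = Some p" if "s \<in> {1..k}" "D s = Some p" for s p
    using that by (auto simp: changed_slots_def)
  show ?thesis
  proof (cases q)
    case (General p)
    then show ?thesis using assms(2) same by (auto simp del: atLeastAtMost_iff)
  next
    case (Specific p j)
    then show ?thesis using assms(2,3) same by auto
  qed
qed

definition final_config :: "'p config list \<Rightarrow> 'p config" where
  "final_config Cs = (if Cs = [] then (\<lambda>_. None) else last Cs)"

lemma final_config_Nil [simp]: "final_config [] = (\<lambda>_. None)"
  by (simp add: final_config_def)

lemma final_config_snoc [simp]: "final_config (Cs @ [C]) = C"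
  by (simp add: final_config_def)

lemma cost_eq_sum_retrievals:
  "cost k Cs = (\<Sum>t<length Cs. retrievals k (final_config (take t Cs)) (Cs ! t))"
proof -
  let ?changed = "\<lambda>t. changed_slots k (final_config (take t Cs)) (Cs ! t)"
  let ?retrieval = "\<lambda>(t, s). (t, s, the ((Cs ! t) s))"
  have previous: "final_config (take t Cs) = (if t = 0 then (\<lambda>_. None) else Cs ! (t - 1))"
    if "t < length Cs" for t
    using that by (auto simp: final_config_def last_conv_nth min_def)
  have "{(t, s, p). t < length Cs \<and> s \<in> {1..k} \<and> retrieved Cs t s p}
      = ?retrieval ` (SIGMA t:{..<length Cs}. ?changed t)" (is "?L = ?R")
  proof (intro equalityI subsetI)
    fix x assume "x \<in> ?L"
    then obtain t s p where "x = (t, s, p)" "t < length Cs" "s \<in> {1..k}" "retrieved Cs t s p"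
      by auto
    then have "x = ?retrieval (t, s)" "(t, s) \<in> (SIGMA t:{..<length Cs}. ?changed t)"
      by (auto simp: retrieved_def changed_slots_def previous)
    then show "x \<in> ?R" by blast
  qed (auto simp: retrieved_def changed_slots_def previous split: if_splits)
  moreover have "inj_on ?retrieval X" for X
    by (auto simp: inj_on_def)
  ultimately show ?thesis
    by (simp add: cost_def retrievals_def card_image)
qed

lemma cost_Nil [simp]: "cost k [] = 0"
  by (simp add: cost_eq_sum_retrievals)

lemma cost_snoc: "cost k (Cs @ [C]) = cost k Cs + retrievals k (final_config Cs) C"
  by (simp add: cost_eq_sum_retrievals nth_append)

section \<open>Online algorithms\<close>

lemma request_sequence_append [simp]:
  "request_sequence k (xs @ ys) \<longleftrightarrow> request_sequence k xs \<and> request_sequence k ys"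
  by (auto simp: request_sequence_def)

lemma request_sequence_concat_replicate:
  "request_sequence k B \<Longrightarrow> request_sequence k (concat (replicate n B))"
  by (auto simp: request_sequence_def)

lemma run_Nil [simp]: "run A [] = []"
  by (simp add: run_def)

lemma run_snoc: "run A (h @ [r]) = run A h @ [A (h @ [r])]"
  by (simp add: run_def)

abbreviation config_after :: "'p online_alg \<Rightarrow> 'p request list \<Rightarrow> 'p config" where
  "config_after A h \<equiv> final_config (run A h)"

lemma cost_run_le: "cost k (run A h) \<le> k * length h"
proof (induction h rule: rev_induct)
  case (snoc r h)
  then show ?case
    using retrievals_le[of k "config_after A h" "A (h @ [r])"] by (simp add: run_snoc cost_snoc)
qed simp

lemma cost_run_append:
  "cost k (run A h) + retrievals k (config_after A h) (config_after A (h @ g))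
    \<le> cost k (run A (h @ g))"
proof (induction g rule: rev_induct)
  case (snoc r g)
  then show ?case
    using retrievals_triangle[of k "config_after A h" "A (h @ g @ [r])" "config_after A (h @ g)"]
    by (simp add: run_snoc cost_snoc flip: append_assoc)
qed simp

definition serves :: "nat \<Rightarrow> 'p online_alg \<Rightarrow> bool" where
  "serves k A \<longleftrightarrow> (\<forall>\<sigma>. request_sequence k \<sigma> \<longrightarrow> is_solution k \<sigma> (run A \<sigma>))"

lemma servesD:
  assumes "serves k A" "request_sequence k (h @ [r])"
  shows "satisfies k (config_after A (h @ [r])) r"
proof -
  have "length (run A h) = length h" by (simp add: run_def)
  moreover have "is_solution k (h @ [r]) (run A (h @ [r]))"
    using assms by (simp add: serves_def)
  then have "satisfies k (run A (h @ [r]) ! length h) ((h @ [r]) ! length h)"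
    unfolding is_solution_def by force
  ultimately show ?thesis by (simp add: run_snoc nth_append)
qed

section \<open>Batches of simultaneous requests\<close>

definition satisfies_all :: "nat \<Rightarrow> 'p config \<Rightarrow> 'p request list \<Rightarrow> bool" where
  "satisfies_all k C B \<longleftrightarrow> (\<forall>q \<in> set B. satisfies k C q)"

definition satisfiable :: "nat \<Rightarrow> 'p request list \<Rightarrow> bool" where
  "satisfiable k B \<longleftrightarrow> request_sequence k B \<and> (\<exists>C. satisfies_all k C B)"

lemma satisfies_all_if_free_round:
  assumes "serves k A" "request_sequence k (h @ B)" "cost k (run A (h @ B)) = cost k (run A h)"
  shows "satisfies_all k (config_after A h) B"
  unfolding satisfies_all_def
proof
  fix q assume "q \<in> set B"
  then obtain B1 B2 where B: "B = B1 @ q # B2" by (meson split_list)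
  let ?g = "h @ B1 @ [q]"
  have "cost k (run A ?g) \<le> cost k (run A (h @ B))"
    using cost_run_append[of k A ?g B2] by (simp add: B)
  then have "retrievals k (config_after A h) (config_after A ?g) = 0"
    using cost_run_append[of k A h "B1 @ [q]"] assms(3) by simp
  moreover have "satisfies k (config_after A ?g) q"
    using servesD[of k A "h @ B1" q] assms(1,2) by (auto simp: B request_sequence_def)
  moreover have "valid_request k q"
    using assms(2) \<open>q \<in> set B\<close> by (simp add: request_sequence_def)
  ultimately show "satisfies k (config_after A h) q"
    by (rule satisfies_if_no_retrievals)
qed

lemma repeated_batch_cases:
  assumes "serves k A" "request_sequence k h" "request_sequence k B"
  obtains n where "n \<le> N" "satisfies_all k (config_after A (h @ concat (replicate n B))) B"
  | "cost k (run A h) + N \<le> cost k (run A (h @ concat (replicate N B)))"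
proof -
  let ?g = "\<lambda>n. h @ concat (replicate n B)"
  have costs: "cost k (run A h) + n \<le> cost k (run A (?g n))"
    if "\<And>m. m < n \<Longrightarrow> \<not> satisfies_all k (config_after A (?g m)) B" for n
    using that
  proof (induction n)
    case (Suc n)
    have round: "?g (Suc n) = ?g n @ B"
      by (simp flip: replicate_append_same)
    have "cost k (run A (?g n @ B)) \<noteq> cost k (run A (?g n))"
      using satisfies_all_if_free_round[OF assms(1), of "?g n" B] Suc.prems[of n] assms(2,3)
      by (auto simp: request_sequence_concat_replicate)
    then have "cost k (run A (?g n)) < cost k (run A (?g (Suc n)))"
      using cost_run_append[of k A "?g n" B] unfolding round by simp
    moreover have "cost k (run A h) + n \<le> cost k (run A (?g n))"
      using Suc by simp
    ultimately show ?case by linarith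
  qed simp
  show thesis
  proof (cases "\<exists>n<N. satisfies_all k (config_after A (?g n)) B")
    case True
    then show ?thesis using that(1) less_imp_le by blast
  next
    case False
    then show ?thesis using that(2) costs[of N] by blast
  qed
qed

text \<open>Here \<open>C\<close> is the configuration of a second cache, which need not agree with that of \<open>A\<close>
  after \<open>h\<close>; this is what allows consecutive detours to be chained.\<close>

definition free_detour ::
    "nat \<Rightarrow> 'p online_alg \<Rightarrow> 'p request list \<Rightarrow> 'p config \<Rightarrow> 'p request list \<Rightarrow> bool" where
  "free_detour k A h D h' \<longleftrightarrow>
     (\<forall>C. cost k (run A h) + retrievals k C D + retrievals k D (config_after A h')
        \<le> cost k (run A h') + retrievals k C (config_after A h))"

lemma free_detour_config_after:
  assumes "h' = h @ g1 @ g2"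
  shows "free_detour k A h (config_after A (h @ g1)) h'"
  unfolding free_detour_def
proof
  fix C
  show "cost k (run A h) + retrievals k C (config_after A (h @ g1))
      + retrievals k (config_after A (h @ g1)) (config_after A h')
    \<le> cost k (run A h') + retrievals k C (config_after A h)"
    using cost_run_append[of k A "h @ g1" g2] cost_run_append[of k A h g1]
      retrievals_triangle[of k C "config_after A (h @ g1)" "config_after A h"]
    by (simp add: assms)
qed

lemma free_detour_if_expensive:
  assumes "cost k (run A h) + 2 * k \<le> cost k (run A h')"
  shows "free_detour k A h D h'"
  unfolding free_detour_def
proof
  fix C
  show "cost k (run A h) + retrievals k C D + retrievals k D (config_after A h')
    \<le> cost k (run A h') + retrievals k C (config_after A h)"
    using assms retrievals_le[of k C D] retrievals_le[of k D "config_after A h'"] by simp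
qed

lemma free_detour_repeated_batch:
  assumes "serves k A" "request_sequence k h" "satisfiable k B"
  obtains D where "satisfies_all k D B" "free_detour k A h D (h @ concat (replicate (2 * k) B))"
proof -
  have B: "request_sequence k B" using assms(3) by (simp add: satisfiable_def)
  show thesis
  proof (rule repeated_batch_cases[OF assms(1,2) B, of "2 * k"])
    fix n
    assume n: "n \<le> 2 * k"
    assume satisfied: "satisfies_all k (config_after A (h @ concat (replicate n B))) B"
    have "h @ concat (replicate (2 * k) B)
        = h @ concat (replicate n B) @ concat (replicate (2 * k - n) B)"
      using n by (simp flip: concat_append replicate_add)
    then show thesis
      by (intro that[OF satisfied] free_detour_config_after)
  next
    assume "cost k (run A h) + 2 * k \<le> cost k (run A (h @ concat (replicate (2 * k) B)))"
    moreover obtain D where "satisfies_all k D B"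
      using assms(3) by (auto simp: satisfiable_def)
    ultimately show thesis by (intro that free_detour_if_expensive)
  qed
qed

type_synonym 'p batch_alg = "'p request list list \<Rightarrow> 'p config"

definition serves_batches :: "nat \<Rightarrow> 'p batch_alg \<Rightarrow> bool" where
  "serves_batches k D \<longleftrightarrow>
     (\<forall>Bs. Bs \<noteq> [] \<longrightarrow> list_all (satisfiable k) Bs \<longrightarrow> satisfies_all k (D Bs) (last Bs))"

primrec batch_cost :: "nat \<Rightarrow> 'p batch_alg \<Rightarrow> 'p request list list \<Rightarrow> nat" where
  "batch_cost k D [] = 0"
| "batch_cost k D (B # Bs) = retrievals k (D []) (D [B]) + batch_cost k (\<lambda>Cs. D (B # Cs)) Bs"

definition repeat_batches :: "nat \<Rightarrow> 'p request list list \<Rightarrow> 'p request list" where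
  "repeat_batches k Bs = concat (map (\<lambda>B. concat (replicate (2 * k) B)) Bs)"

lemma serves_batchesD:
  "serves_batches k D \<Longrightarrow> list_all (satisfiable k) (Bs @ [B]) \<Longrightarrow> satisfies_all k (D (Bs @ [B])) B"
  unfolding serves_batches_def by (metis Nil_is_append_conv last_snoc not_Cons_self2)

lemma serves_batches_shift:
  "serves_batches k D \<Longrightarrow> list_all (satisfiable k) Bs \<Longrightarrow> serves_batches k (\<lambda>Cs. D (Bs @ Cs))"
  unfolding serves_batches_def by (metis append_is_Nil_conv last_appendR list_all_append)

lemma batch_cost_append:
  "batch_cost k D (Bs @ Cs) = batch_cost k D Bs + batch_cost k (\<lambda>Ds. D (Bs @ Ds)) Cs"
  by (induction Bs arbitrary: D) auto

lemma repeat_batches_simps [simp]: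
  "repeat_batches k [] = []"
  "repeat_batches k (Bs @ Cs) = repeat_batches k Bs @ repeat_batches k Cs"
  by (simp_all add: repeat_batches_def)

lemma repeat_batches_snoc:
  "repeat_batches k (Bs @ [B]) = repeat_batches k Bs @ concat (replicate (2 * k) B)"
  by (simp add: repeat_batches_def)

lemma set_repeat_batches: "set (repeat_batches k Bs) \<subseteq> \<Union> (set ` set Bs)"
  by (auto simp: repeat_batches_def)

lemma request_sequence_repeat_batches:
  "list_all (satisfiable k) Bs \<Longrightarrow> request_sequence k (repeat_batches k Bs)"
  using set_repeat_batches[of k Bs]
  by (fastforce simp: request_sequence_def satisfiable_def list_all_iff)

lemma batch_cost_le_if_free_detours:
  assumes "D [] = (\<lambda>_. None)"
    and "\<And>Bs B. list_all (satisfiable k) (Bs @ [B]) \<Longrightarrow>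
      free_detour k A (repeat_batches k Bs) (D (Bs @ [B])) (repeat_batches k (Bs @ [B]))"
    and "list_all (satisfiable k) Bs"
  shows "batch_cost k D Bs + retrievals k (D Bs) (config_after A (repeat_batches k Bs))
    \<le> cost k (run A (repeat_batches k Bs))"
  using assms(3)
proof (induction Bs rule: rev_induct)
  case (snoc B Bs)
  let ?h = "repeat_batches k Bs" and ?h' = "repeat_batches k (Bs @ [B])"
  have "cost k (run A ?h) + retrievals k (D Bs) (D (Bs @ [B]))
      + retrievals k (D (Bs @ [B])) (config_after A ?h')
    \<le> cost k (run A ?h') + retrievals k (D Bs) (config_after A ?h)"
    using assms(2)[OF snoc.prems] unfolding free_detour_def by blast
  then show ?case using snoc by (simp add: batch_cost_append)
qed (simp add: assms(1))

lemma batch_alg_of_online_alg: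
  fixes A :: "'p online_alg"
  assumes "serves k A"
  obtains D where "D [] = (\<lambda>_. None)" "serves_batches k D"
    "\<And>Bs. list_all (satisfiable k) Bs \<Longrightarrow> batch_cost k D Bs \<le> cost k (run A (repeat_batches k Bs))"
proof -
  define served where "served Bs B C \<longleftrightarrow> satisfies_all k C B \<and>
      free_detour k A (repeat_batches k Bs) C (repeat_batches k (Bs @ [B]))" for Bs B C
  define D where "D Bs = (if Bs = [] then (\<lambda>_. None)
      else SOME C. served (butlast Bs) (last Bs) C)" for Bs
  have D_Nil: "D [] = (\<lambda>_. None)" by (simp add: D_def)
  have served: "served Bs B (D (Bs @ [B]))" if "list_all (satisfiable k) (Bs @ [B])" for Bs B
  proof -
    have "request_sequence k (repeat_batches k Bs)" "satisfiable k B"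
      using that by (simp_all add: request_sequence_repeat_batches)
    then have "\<exists>C. served Bs B C"
      using free_detour_repeated_batch[OF assms] unfolding served_def
      by (metis repeat_batches_snoc)
    then show ?thesis by (simp add: D_def someI_ex)
  qed
  have "serves_batches k D"
    unfolding serves_batches_def
  proof (intro allI impI)
    fix Bs :: "'p request list list"
    assume "Bs \<noteq> []" "list_all (satisfiable k) Bs"
    then show "satisfies_all k (D Bs) (last Bs)"
      using served[of "butlast Bs" "last Bs"] by (simp add: served_def)
  qed
  moreover have "free_detour k A (repeat_batches k Bs) (D (Bs @ [B])) (repeat_batches k (Bs @ [B]))"
    if "list_all (satisfiable k) (Bs @ [B])" for Bs B
    using served[OF that] by (simp add: served_def)
  then have "batch_cost k D Bs \<le> cost k (run A (repeat_batches k Bs))"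
    if "list_all (satisfiable k) Bs" for Bs
    using batch_cost_le_if_free_detours[where D = D, OF D_Nil _ that, of A] by (meson add_leD1)
  ultimately show thesis using D_Nil that by blast
qed

section \<open>Phases\<close>

text \<open>Throughout a phase, \<open>c j\<close> is the page of slot \<open>j\<close> at the start of the phase, and \<open>c 0\<close> is
  the page to be brought in. The slots \<open>ys\<close> have been requested already and the slots \<open>xs\<close> follow,
  except for the last one: the optimal solution puts \<open>c 0\<close> there, and the page evicted from it is
  the new page of the next phase.\<close>

definition batch :: "(nat \<Rightarrow> 'p) \<Rightarrow> nat list \<Rightarrow> 'p request list" where
  "batch c ys = General (c 0) # map (\<lambda>j. Specific (c j) j) ys"

primrec phase :: "(nat \<Rightarrow> 'p) \<Rightarrow> nat list \<Rightarrow> nat list \<Rightarrow> 'p request list list" where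
  "phase c ys [] = []"
| "phase c ys (x # xs) = batch c ys # phase c (ys @ [x]) xs"

definition swap_in :: "(nat \<Rightarrow> 'p) \<Rightarrow> nat \<Rightarrow> nat \<Rightarrow> 'p" where
  "swap_in c s = c \<circ> Transposition.transpose 0 s"

primrec phases :: "(nat \<Rightarrow> 'p) \<Rightarrow> nat list list \<Rightarrow> 'p request list list" where
  "phases c [] = []"
| "phases c (xs # xss) = phase c [] xs @ phases (swap_in c (last xs)) xss"

definition full_config :: "(nat \<Rightarrow> 'p) \<Rightarrow> 'p config" where
  "full_config c s = Some (c s)"

lemma swap_in_simps [simp]:
  "swap_in c s s = c 0" "swap_in c s 0 = c s" "j \<noteq> 0 \<Longrightarrow> j \<noteq> s \<Longrightarrow> swap_in c s j = c j"
  by (simp_all add: swap_in_def)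

lemma inj_swap_in: "inj c \<Longrightarrow> inj (swap_in c s)"
  by (simp add: swap_in_def inj_compose)

definition holders :: "nat \<Rightarrow> 'p config \<Rightarrow> 'p \<Rightarrow> nat set" where
  "holders k C p = {s \<in> {1..k}. C s = Some p}"

lemma finite_holders [simp]: "finite (holders k C p)"
  by (simp add: holders_def)

lemma satisfies_all_batch_iff:
  "satisfies_all k C (batch c ys) \<longleftrightarrow> holders k C (c 0) \<noteq> {} \<and> (\<forall>j \<in> set ys. C j = Some (c j))"
  by (auto simp: satisfies_all_def batch_def holders_def)

lemma full_config_satisfies_batch:
  assumes "s \<in> {1..k}" "set ys \<subseteq> {1..k} - {s}"
  shows "satisfies_all k (full_config (swap_in c s)) (batch c ys)"
proof -
  have "full_config (swap_in c s) s = Some (c 0)"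
    by (simp add: full_config_def)
  moreover have "full_config (swap_in c s) j = Some (c j)" if "j \<in> set ys" for j
  proof -
    have "j \<noteq> 0" "j \<noteq> s" using that assms(2) by auto
    then show ?thesis by (simp add: full_config_def)
  qed
  ultimately show ?thesis using assms(1) by (auto simp: satisfies_all_batch_iff holders_def)
qed

lemma satisfiable_batch:
  assumes "set ys \<subset> {1..k}"
  shows "satisfiable k (batch c ys)"
proof -
  obtain s where "s \<in> {1..k}" "set ys \<subseteq> {1..k} - {s}"
    using assms by blast
  then have "satisfies_all k (full_config (swap_in c s)) (batch c ys)"
    by (rule full_config_satisfies_batch)
  moreover have "request_sequence k (batch c ys)"
    using assms by (auto simp: request_sequence_def batch_def)
  ultimately show ?thesis by (auto simp: satisfiable_def)
qed

lemma holders_subset_if_satisfies_batch: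
  assumes "inj c" "satisfies_all k C (batch c ys)" "0 \<notin> set ys"
  shows "holders k C (c 0) \<subseteq> {1..k} - set ys"
proof
  fix j assume j: "j \<in> holders k C (c 0)"
  have "j \<notin> set ys"
  proof
    assume "j \<in> set ys"
    then have "c j = c 0" using j assms(2) by (simp add: holders_def satisfies_all_batch_iff)
    then have "j = 0" using assms(1) by (auto dest: injD)
    with \<open>j \<in> set ys\<close> assms(3) show False by simp
  qed
  then show "j \<in> {1..k} - set ys" using j by (simp add: holders_def)
qed

lemma config_eq_swap_in:
  assumes "inj c" "satisfies_all k C (batch c ys)" "set ys = {1..k} - {s}" "j \<in> {1..k}"
  shows "C j = Some (swap_in c s j)"
proof (cases "j = s")
  case True
  have "holders k C (c 0) \<subseteq> {1..k} - set ys"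
    using assms(1-3) by (intro holders_subset_if_satisfies_batch) auto
  then have "C s = Some (c 0)"
    using assms(2,3) by (auto simp: satisfies_all_batch_iff holders_def)
  then show ?thesis using True by simp
next
  case False
  then have "j \<in> set ys" "j \<noteq> 0" using assms(3,4) by auto
  then show ?thesis using assms(2) False by (simp add: satisfies_all_batch_iff)
qed

lemma batch_in_phase:
  assumes "B \<in> set (phase c ys xs)"
  obtains zs where "B = batch c (ys @ zs)" "set zs \<subseteq> set (butlast xs)"
proof -
  have "\<exists>zs. B = batch c (ys @ zs) \<and> set zs \<subseteq> set (butlast xs)"
    using assms
  proof (induction xs arbitrary: ys)
    case (Cons x xs)
    show ?case
    proof (cases "B = batch c ys")
      case False
      then have "B \<in> set (phase c (ys @ [x]) xs)" "xs \<noteq> []" using Cons.prems by auto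
      then obtain zs where "B = batch c (ys @ x # zs)" "set zs \<subseteq> set (butlast xs)"
        using Cons.IH by fastforce
      then show ?thesis using \<open>xs \<noteq> []\<close> by (intro exI[of _ "x # zs"]) auto
    qed (auto intro: exI[of _ "[]"])
  qed simp
  then show thesis using that by blast
qed

lemma last_phase: "xs \<noteq> [] \<Longrightarrow> phase c ys xs \<noteq> [] \<and> last (phase c ys xs) = batch c (ys @ butlast xs)"
  by (induction xs arbitrary: ys) auto

lemma permutation_slots:
  fixes k :: nat
  assumes "xs \<in> permutations_of_set {1..k}" "k \<ge> 1"
  shows "xs \<noteq> []" "last xs \<in> {1..k}" "set (butlast xs) = {1..k} - {last xs}"
proof -
  have xs: "set xs = {1..k}" "distinct xs" using assms(1) by (auto dest: permutations_of_setD)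
  then have "k \<in> set xs" using assms(2) by simp
  then show "xs \<noteq> []" by auto
  then obtain ys y where "xs = ys @ [y]" by (meson rev_exhaust)
  with xs show "last xs \<in> {1..k}" "set (butlast xs) = {1..k} - {last xs}" by auto
qed

lemma full_config_satisfies_phase:
  assumes "xs \<in> permutations_of_set {1..k}" "k \<ge> 1" "B \<in> set (phase c [] xs)"
  shows "satisfies_all k (full_config (swap_in c (last xs))) B" "satisfiable k B"
proof -
  obtain zs where "B = batch c zs" "set zs \<subseteq> set (butlast xs)"
    using assms(3) by (auto elim: batch_in_phase)
  then show "satisfies_all k (full_config (swap_in c (last xs))) B" "satisfiable k B"
    using permutation_slots[OF assms(1,2)]
    by (auto intro!: full_config_satisfies_batch satisfiable_batch)
qed

lemma satisfiable_phases:
  assumes "xss \<in> lists (permutations_of_set {1..k})" "k \<ge> 1"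
  shows "list_all (satisfiable k) (phases c xss)"
  using assms by (induction xss arbitrary: c) (auto simp: list_all_iff full_config_satisfies_phase)

section \<open>The cost of random phases\<close>

lemma expectation_bind_pmf:
  fixes h :: "'b \<Rightarrow> real"
  assumes "finite (set_pmf p)" "\<And>x. x \<in> set_pmf p \<Longrightarrow> finite (set_pmf (f x))"
  shows "measure_pmf.expectation (p \<bind> f) h
    = measure_pmf.expectation p (\<lambda>x. measure_pmf.expectation (f x) h)"
  using assms
  by (simp add: pmf_expectation_bind[of "set_pmf p"] integral_measure_pmf[of "set_pmf p"])

lemma expectation_mono_pmf:
  fixes f g :: "'a \<Rightarrow> real"
  assumes "finite (set_pmf p)" "\<And>x. x \<in> set_pmf p \<Longrightarrow> f x \<le> g x"
  shows "measure_pmf.expectation p f \<le> measure_pmf.expectation p g"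
  using assms by (intro integral_mono_AE integrable_measure_pmf_finite AE_pmfI)

abbreviation random_order :: "'a set \<Rightarrow> 'a list pmf" where
  "random_order R \<equiv> pmf_of_set (permutations_of_set R)"

lemma expectation_random_order:
  fixes f :: "'a list \<Rightarrow> real"
  assumes "finite R" "R \<noteq> {}"
  shows "measure_pmf.expectation (random_order R) f = measure_pmf.expectation (pmf_of_set R)
    (\<lambda>x. measure_pmf.expectation (random_order (R - {x})) (\<lambda>xs. f (x # xs)))"
  using assms
  by (subst random_permutation_of_set) (simp_all add: expectation_bind_pmf flip: map_pmf_def)

lemma expectation_random_order_ge:
  fixes f :: "'a list \<Rightarrow> real"
  assumes "finite R" "R \<noteq> {}" "S \<subseteq> R"
    and "\<And>x. x \<in> R \<Longrightarrow> v + b * of_bool (x \<in> S)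
      \<le> measure_pmf.expectation (random_order (R - {x})) (\<lambda>xs. f (x # xs))"
  shows "v + b * (card S / card R) \<le> measure_pmf.expectation (random_order R) f"
proof -
  have "(\<Sum>x\<in>R. v + b * of_bool (x \<in> S)) = card R * v + b * card (R \<inter> S)"
    using assms(1)
    by (simp add: sum.distrib of_bool_def sum.If_cases Int_def flip: sum_distrib_left)
  moreover have "R \<inter> S = S" using assms(3) by blast
  ultimately have "v + b * (card S / card R)
      = measure_pmf.expectation (pmf_of_set R) (\<lambda>x. v + b * of_bool (x \<in> S))"
    using assms(1,2) by (simp add: integral_pmf_of_set field_simps)
  also have "\<dots> \<le> measure_pmf.expectation (random_order R) f"
    unfolding expectation_random_order[OF assms(1,2)]
    using assms by (intro expectation_mono_pmf) auto
  finally show ?thesis .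
qed

lemma finite_set_replicate_pmf:
  assumes "finite (set_pmf p)"
  shows "finite (set_pmf (replicate_pmf n p))"
  using finite_lists_length_eq[OF assms]
  by (simp add: set_replicate_pmf lists_eq_set Collect_conj_eq)

lemma expectation_replicate_pmf_Suc:
  fixes f :: "'a list \<Rightarrow> real"
  assumes "finite (set_pmf p)"
  shows "measure_pmf.expectation (replicate_pmf (Suc n) p) f = measure_pmf.expectation p
    (\<lambda>x. measure_pmf.expectation (replicate_pmf n p) (\<lambda>xs. f (x # xs)))"
  using assms by (simp add: expectation_bind_pmf finite_set_replicate_pmf flip: map_pmf_def)

lemma harm_ge_one: "n \<ge> 1 \<Longrightarrow> harm n \<ge> (1::real)"
  using harm_mono[of 1 n, where 'a = real] by (simp add: harm_expand)

lemma retrievals_ge_holders: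
  assumes "j \<in> {1..k}" "D j = Some q" "q \<noteq> p"
  shows "card (holders k D p) + 2 * of_bool (j \<in> holders k C p)
    \<le> retrievals k C D + card (holders k C p)"
proof -
  let ?S = "holders k C p" and ?S' = "holders k D p" and ?J = "{j} \<inter> holders k C p"
  have j: "j \<notin> ?S'" using assms by (simp add: holders_def)
  have "card (?S' - ?S) + card ?J = card ((?S' - ?S) \<union> ?J)"
    using j by (intro card_Un_disjoint[symmetric]) auto
  also have "\<dots> \<le> retrievals k C D"
    unfolding retrievals_def using assms
    by (intro card_mono) (auto simp: changed_slots_def holders_def)
  finally have new: "card (?S' - ?S) + card ?J \<le> retrievals k C D" .
  have "card (?S' \<inter> ?S) + card ?J = card ((?S' \<inter> ?S) \<union> ?J)"
    using j by (intro card_Un_disjoint[symmetric]) auto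
  also have "\<dots> \<le> card ?S" by (intro card_mono) auto
  finally have old: "card (?S' \<inter> ?S) + card ?J \<le> card ?S" .
  have "card ?S' = card (?S' \<inter> ?S) + card (?S' - ?S)"
    by (rule card_Int_Diff) simp
  moreover have "card ?J = of_bool (j \<in> ?S)" by auto
  ultimately show ?thesis using new old by linarith
qed

text \<open>The number of slots holding the new page acts as a potential: each surplus copy costs one
  retrieval and saves at most one later.\<close>

definition phase_bound :: "nat \<Rightarrow> (nat \<Rightarrow> 'p) \<Rightarrow> nat list \<Rightarrow> 'p batch_alg \<Rightarrow> real" where
  "phase_bound k c ys D = 2 * harm (card ({1..k} - set ys)) - 1
     + real (retrievals k (D []) (D [batch c ys])) - real (card (holders k (D [batch c ys]) (c 0)))"

lemma phase_bound_step:
  fixes c :: "nat \<Rightarrow> 'p" and D ys k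
  defines "R \<equiv> {1..k} - set ys" and "C \<equiv> D [batch c ys]"
  assumes "inj c" "serves_batches k D" "set ys \<subseteq> {1..k}" "x \<in> R" "R \<noteq> {x}"
  shows "phase_bound k c ys D - 2 / card R + 2 * of_bool (x \<in> holders k C (c 0))
    \<le> real (retrievals k (D []) C) + phase_bound k c (ys @ [x]) (\<lambda>Bs. D (batch c ys # Bs))"
proof -
  define E where "E = D [batch c ys, batch c (ys @ [x])]"
  have x: "x \<in> {1..k}" "x \<notin> set ys" using \<open>x \<in> R\<close> by (auto simp: R_def)
  have "set ys \<subset> {1..k}" "set (ys @ [x]) \<subset> {1..k}"
    using \<open>x \<in> R\<close> \<open>R \<noteq> {x}\<close> assms(5) unfolding R_def by auto
  then have "list_all (satisfiable k) [batch c ys, batch c (ys @ [x])]"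
    by (simp add: satisfiable_batch del: set_append)
  then have "satisfies_all k E (batch c (ys @ [x]))"
    using serves_batchesD[OF assms(4), of "[batch c ys]" "batch c (ys @ [x])"] by (simp add: E_def)
  then have "E x = Some (c x)" by (simp add: satisfies_all_batch_iff)
  moreover have "c x \<noteq> c 0" using assms(3) x(1) by (auto dest: injD)
  ultimately have "card (holders k E (c 0)) + 2 * of_bool (x \<in> holders k C (c 0))
      \<le> retrievals k C E + card (holders k C (c 0))"
    using x(1) by (intro retrievals_ge_holders) auto
  then have "real (card (holders k E (c 0))) + 2 * of_bool (x \<in> holders k C (c 0))
      \<le> real (retrievals k C E) + real (card (holders k C (c 0)))"
    by (simp add: of_bool_def split: if_splits)
  moreover have "2 * harm (card R) = 2 * harm (card ({1..k} - set (ys @ [x]))) + 2 / real (card R)"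
  proof -
    have "card R = Suc (card (R - {x}))"
      using \<open>x \<in> R\<close> by (intro card.remove) (simp_all add: R_def)
    moreover have "R - {x} = {1..k} - set (ys @ [x])"
      by (auto simp: R_def)
    ultimately show ?thesis by (simp add: harm_Suc inverse_eq_divide)
  qed
  ultimately show ?thesis
    unfolding phase_bound_def C_def[symmetric] E_def[symmetric] R_def[symmetric] by linarith
qed

lemma holders_after_batch:
  assumes "inj c" "serves_batches k D" "set ys \<subset> {1..k}"
  defines "S \<equiv> holders k (D [batch c ys]) (c 0)"
  shows "S \<subseteq> {1..k} - set ys" "card S \<ge> 1"
proof -
  have satisfied: "satisfies_all k (D [batch c ys]) (batch c ys)"
    using serves_batchesD[OF assms(2), of "[]" "batch c ys"] satisfiable_batch[OF assms(3), of c]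
    by simp
  show "S \<subseteq> {1..k} - set ys"
    unfolding S_def using assms(3)
    by (intro holders_subset_if_satisfies_batch[OF assms(1) satisfied]) auto
  show "card S \<ge> 1"
    using satisfied by (simp add: S_def satisfies_all_batch_iff Suc_le_eq card_gt_0_iff)
qed

lemma phase_cost_step:
  fixes c :: "nat \<Rightarrow> 'p" and D ys k
  defines "R \<equiv> {1..k} - set ys"
  assumes "inj c" "serves_batches k D" "set ys \<subseteq> {1..k}" "x \<in> R" "R \<noteq> {x}"
    and remaining: "phase_bound k c (ys @ [x]) (\<lambda>Bs. D (batch c ys # Bs))
      \<le> measure_pmf.expectation (random_order (R - {x}))
          (\<lambda>xs. real (batch_cost k (\<lambda>Bs. D (batch c ys # Bs)) (phase c (ys @ [x]) xs)))"
  shows "phase_bound k c ys D - 2 / card R + 2 * of_bool (x \<in> holders k (D [batch c ys]) (c 0))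
    \<le> measure_pmf.expectation (random_order (R - {x}))
        (\<lambda>xs. real (batch_cost k D (phase c ys (x # xs))))"
proof -
  have "finite R" by (simp add: R_def)
  moreover have "phase_bound k c ys D - 2 / card R
      + 2 * of_bool (x \<in> holders k (D [batch c ys]) (c 0))
    \<le> real (retrievals k (D []) (D [batch c ys]))
      + phase_bound k c (ys @ [x]) (\<lambda>Bs. D (batch c ys # Bs))"
    using assms(2-6) unfolding R_def by (rule phase_bound_step)
  ultimately show ?thesis
    using remaining by (simp add: integrable_measure_pmf_finite)
qed

lemma phase_cost_lower_bound:
  fixes c :: "nat \<Rightarrow> 'p"
  assumes "inj c" "serves_batches k D" "set ys \<subset> {1..k}"
  shows "phase_bound k c ys D \<le> measure_pmf.expectation (random_order ({1..k} - set ys))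
    (\<lambda>xs. real (batch_cost k D (phase c ys xs)))"
  using assms(2,3)
proof (induction "card ({1..k} - set ys)" arbitrary: ys D rule: less_induct)
  case less
  define R where "R = {1..k} - set ys"
  define S where "S = holders k (D [batch c ys]) (c 0)"
  have S: "S \<subseteq> R" "card S \<ge> 1"
    using holders_after_batch[OF assms(1) less.prems] by (simp_all add: S_def R_def)
  have R: "finite R" "R \<noteq> {}" using less.prems(2) by (auto simp: R_def)
  show ?case
  proof (cases "\<exists>s. R = {s}")
    case True
    then obtain s where "{1..k} - set ys = {s}" by (auto simp: R_def)
    then show ?thesis
      using S(2) by (simp add: phase_bound_def S_def harm_expand pmf_of_set_singleton)
  next
    case False
    let ?D = "\<lambda>Bs. D (batch c ys # Bs)"
    have step: "phase_bound k c ys D - 2 / card R + 2 * of_bool (x \<in> S)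
      \<le> measure_pmf.expectation (random_order (R - {x}))
          (\<lambda>xs. real (batch_cost k D (phase c ys (x # xs))))" if "x \<in> R" for x
    proof -
      have remaining: "R - {x} = {1..k} - set (ys @ [x])" by (auto simp: R_def)
      then have "card ({1..k} - set (ys @ [x])) < card ({1..k} - set ys)"
        using card_Diff1_less[OF R(1) that] by (simp only: flip: R_def)
      moreover have "serves_batches k ?D"
        using serves_batches_shift[OF less.prems(1), of "[batch c ys]"]
          satisfiable_batch[OF less.prems(2), of c] by simp
      moreover have "set (ys @ [x]) \<subset> {1..k}"
        using that False less.prems(2) unfolding R_def by auto
      ultimately show ?thesis
        using less.hyps[of "ys @ [x]" ?D] assms(1) less.prems that False
        unfolding S_def remaining[symmetric] R_def by (intro phase_cost_step) auto
    qed
    have "phase_bound k c ys D \<le> phase_bound k c ys D - 2 / card R + 2 * (card S / card R)"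
      using S(2) by (simp add: divide_right_mono)
    also have "\<dots> \<le> measure_pmf.expectation (random_order R)
        (\<lambda>xs. real (batch_cost k D (phase c ys xs)))"
      using R S(1) step by (rule expectation_random_order_ge)
    finally show ?thesis by (simp add: R_def)
  qed
qed

lemma full_phase_cost_lower_bound:
  fixes c :: "nat \<Rightarrow> 'p"
  assumes "inj c" "k \<ge> 1" "serves_batches k D" "holders k (D []) (c 0) = {}"
  shows "2 * harm k - 1
    \<le> measure_pmf.expectation (random_order {1..k}) (\<lambda>xs. real (batch_cost k D (phase c [] xs)))"
proof -
  let ?C = "D [batch c []]"
  have "card (holders k ?C (c 0)) \<le> retrievals k (D []) ?C"
    unfolding retrievals_def using assms(4)
    by (intro card_mono) (auto simp: changed_slots_def holders_def)
  then have "2 * harm k - 1 \<le> phase_bound k c [] D"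
    by (simp add: phase_bound_def)
  also have "\<dots> \<le> measure_pmf.expectation (random_order {1..k})
      (\<lambda>xs. real (batch_cost k D (phase c [] xs)))"
    using phase_cost_lower_bound[OF assms(1,3), of "[]"] assms(2) by (simp add: psubset_eq)
  finally show ?thesis .
qed

lemma holders_after_phase:
  assumes "inj c" "k \<ge> 1" "serves_batches k D" "xs \<in> permutations_of_set {1..k}"
  shows "holders k (D (phase c [] xs)) (swap_in c (last xs) 0) = {}"
proof -
  have "list_all (satisfiable k) (phase c [] xs)"
    using full_config_satisfies_phase[OF assms(4,2)] by (auto simp: list_all_iff)
  then have "satisfies_all k (D (phase c [] xs)) (batch c (butlast xs))"
    using assms(3) last_phase[of xs c "[]"] permutation_slots(1)[OF assms(4,2)]
    unfolding serves_batches_def by fastforce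
  then have "D (phase c [] xs) j = Some (swap_in c (last xs) j)" if "j \<in> {1..k}" for j
    using assms(1) permutation_slots(3)[OF assms(4,2)] that by (intro config_eq_swap_in) auto
  then show ?thesis
    using inj_swap_in[OF assms(1), of "last xs"]
    by (auto simp: holders_def dest: injD simp del: swap_in_simps)
qed

abbreviation random_orders :: "nat \<Rightarrow> nat \<Rightarrow> nat list list pmf" where
  "random_orders k n \<equiv> replicate_pmf n (random_order {1..k})"

lemma phases_cost_lower_bound:
  fixes c :: "nat \<Rightarrow> 'p"
  assumes "inj c" "k \<ge> 1" "serves_batches k D" "holders k (D []) (c 0) = {}"
  shows "real n * (2 * harm k - 1)
    \<le> measure_pmf.expectation (random_orders k n) (\<lambda>xss. real (batch_cost k D (phases c xss)))"
  using assms(1,3,4)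
proof (induction n arbitrary: c D)
  case (Suc n)
  have finite: "finite (set_pmf (random_order {1..k}))" by simp
  have step: "real (batch_cost k D (phase c [] xs)) + real n * (2 * harm k - 1)
      \<le> measure_pmf.expectation (random_orders k n)
          (\<lambda>xss. real (batch_cost k D (phases c (xs # xss))))"
    if xs: "xs \<in> permutations_of_set {1..k}" for xs
  proof -
    let ?D = "\<lambda>Bs. D (phase c [] xs @ Bs)"
    have "list_all (satisfiable k) (phase c [] xs)"
      using full_config_satisfies_phase[OF xs assms(2)] by (auto simp: list_all_iff)
    then have "real n * (2 * harm k - 1) \<le> measure_pmf.expectation (random_orders k n)
        (\<lambda>xss. real (batch_cost k ?D (phases (swap_in c (last xs)) xss)))"
      using Suc.prems holders_after_phase[OF Suc.prems(1) assms(2) Suc.prems(2) xs]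
      by (intro Suc.IH inj_swap_in serves_batches_shift) simp_all
    then show ?thesis
      by (simp add: batch_cost_append integrable_measure_pmf_finite finite_set_replicate_pmf)
  qed
  have "real (Suc n) * (2 * harm k - 1) = (2 * harm k - 1) + real n * (2 * harm k - 1)"
    by (simp add: algebra_simps)
  also have "\<dots> \<le> measure_pmf.expectation (random_order {1..k})
      (\<lambda>xs. real (batch_cost k D (phase c [] xs)) + real n * (2 * harm k - 1))"
    using full_phase_cost_lower_bound[OF Suc.prems(1) assms(2) Suc.prems(2,3)]
    by (simp add: integrable_measure_pmf_finite)
  also have "\<dots> \<le> measure_pmf.expectation (random_orders k (Suc n))
      (\<lambda>xss. real (batch_cost k D (phases c xss)))"
    unfolding expectation_replicate_pmf_Suc[OF finite]
    using step by (intro expectation_mono_pmf) auto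
  finally show ?case .
qed simp

lemma online_cost_lower_bound:
  fixes c :: "nat \<Rightarrow> 'p" and A :: "'p online_alg"
  assumes "inj c" "k \<ge> 1" "serves k A"
  shows "real n * (2 * harm k - 1) \<le> measure_pmf.expectation (random_orders k n)
    (\<lambda>xss. real (cost k (run A (repeat_batches k (phases c xss)))))"
proof -
  obtain D where D: "D [] = (\<lambda>_. None)" "serves_batches k D"
    "\<And>Bs. list_all (satisfiable k) Bs \<Longrightarrow> batch_cost k D Bs \<le> cost k (run A (repeat_batches k Bs))"
    using batch_alg_of_online_alg[OF assms(3)] by blast
  have "real n * (2 * harm k - 1)
      \<le> measure_pmf.expectation (random_orders k n) (\<lambda>xss. real (batch_cost k D (phases c xss)))"
    using assms(1,2) D(1,2) by (intro phases_cost_lower_bound) (simp_all add: holders_def)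
  also have "\<dots> \<le> measure_pmf.expectation (random_orders k n)
      (\<lambda>xss. real (cost k (run A (repeat_batches k (phases c xss)))))"
  proof (rule expectation_mono_pmf)
    fix xss assume "xss \<in> set_pmf (random_orders k n)"
    then have "list_all (satisfiable k) (phases c xss)"
      using assms(2) by (intro satisfiable_phases) (auto simp: set_replicate_pmf)
    then show "real (batch_cost k D (phases c xss))
        \<le> real (cost k (run A (repeat_batches k (phases c xss))))"
      using D(3) by simp
  qed (simp add: finite_set_replicate_pmf)
  finally show ?thesis .
qed

section \<open>The optimal cost of the phases\<close>

definition reachable :: "nat \<Rightarrow> 'p request list \<Rightarrow> 'p config \<Rightarrow> nat \<Rightarrow> bool" where
  "reachable k \<sigma> C x \<longleftrightarrow>
     (\<exists>Cs. is_solution k \<sigma> Cs \<and> cost k Cs + retrievals k (final_config Cs) C \<le> x)"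

lemma reachable_Nil: "reachable k [] C k"
  unfolding reachable_def by (intro exI[of _ "[]"]) (auto simp: is_solution_def retrievals_le)

lemma reachable_append:
  assumes "reachable k \<sigma> C x" "satisfies_all k C B"
  shows "reachable k (\<sigma> @ B) C x"
  using assms(2)
proof (induction B rule: rev_induct)
  case Nil
  then show ?case using assms(1) by simp
next
  case (snoc q B)
  then obtain Cs where Cs: "is_solution k (\<sigma> @ B) Cs"
    "cost k Cs + retrievals k (final_config Cs) C \<le> x"
    by (auto simp: reachable_def satisfies_all_def)
  have "is_solution k (\<sigma> @ B @ [q]) (Cs @ [C])"
    using Cs(1) snoc.prems
    by (auto simp: is_solution_def satisfies_all_def nth_append less_Suc_eq simp flip: append_assoc)
  moreover have "cost k (Cs @ [C]) + retrievals k (final_config (Cs @ [C])) C \<le> x"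
    using Cs(2) by (simp add: cost_snoc)
  ultimately show ?case unfolding reachable_def by blast
qed

lemma reachable_change_config:
  assumes "reachable k \<sigma> C x" "retrievals k C D \<le> y"
  shows "reachable k \<sigma> D (x + y)"
proof -
  obtain Cs where "is_solution k \<sigma> Cs" "cost k Cs + retrievals k (final_config Cs) C \<le> x"
    using assms(1) by (auto simp: reachable_def)
  then show ?thesis
    using assms(2) retrievals_triangle[of k "final_config Cs" D C] unfolding reachable_def
    by (intro exI[of _ Cs]) auto
qed

lemma OPT_le_if_reachable:
  assumes "reachable k \<sigma> C x"
  shows "OPT k \<sigma> \<le> x"
proof -
  obtain Cs where "is_solution k \<sigma> Cs" "cost k Cs \<le> x"
    using assms unfolding reachable_def by (metis add_leD1)
  moreover from this(1) have "OPT k \<sigma> \<le> cost k Cs"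
    unfolding OPT_def by (intro cInf_lower) auto
  ultimately show ?thesis by simp
qed

lemma retrievals_swap_in_le: "retrievals k (full_config c) (full_config (swap_in c s)) \<le> 1"
proof -
  have "changed_slots k (full_config c) (full_config (swap_in c s)) \<subseteq> {s}"
  proof
    fix j assume "j \<in> changed_slots k (full_config c) (full_config (swap_in c s))"
    then have "j \<noteq> 0" "swap_in c s j \<noteq> c j"
      by (auto simp: changed_slots_def full_config_def)
    then show "j \<in> {s}" by (auto intro: ccontr)
  qed
  then have "card (changed_slots k (full_config c) (full_config (swap_in c s))) \<le> card {s}"
    by (intro card_mono) auto
  then show ?thesis by (simp add: retrievals_def)
qed

lemma reachable_phase:
  assumes "reachable k \<sigma> (full_config c) x" "xs \<in> permutations_of_set {1..k}" "k \<ge> 1"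
  shows "reachable k (\<sigma> @ repeat_batches k (phase c [] xs))
    (full_config (swap_in c (last xs))) (Suc x)"
proof -
  let ?C = "full_config (swap_in c (last xs))"
  have "reachable k \<sigma> ?C (Suc x)"
    using reachable_change_config[OF assms(1) retrievals_swap_in_le] by simp
  moreover have "satisfies_all k ?C (repeat_batches k (phase c [] xs))"
    using full_config_satisfies_phase(1)[OF assms(2,3)] set_repeat_batches
    unfolding satisfies_all_def by fast
  ultimately show ?thesis by (rule reachable_append)
qed

lemma OPT_phases_le:
  assumes "xss \<in> lists (permutations_of_set {1..k})" "k \<ge> 1"
  shows "OPT k (repeat_batches k (phases c xss)) \<le> k + length xss"
proof -
  have "\<exists>C. reachable k (\<sigma> @ repeat_batches k (phases c xss)) C (x + length xss)"
    if "reachable k \<sigma> (full_config c) x" for \<sigma> x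
    using assms(1) that
  proof (induction xss arbitrary: c \<sigma> x)
    case (Cons xs xss)
    then have "reachable k (\<sigma> @ repeat_batches k (phase c [] xs))
        (full_config (swap_in c (last xs))) (Suc x)"
      using assms(2) by (auto intro: reachable_phase)
    from Cons.IH[OF this] show ?case by simp
  qed auto
  from this[OF reachable_Nil] show ?thesis
    by (auto intro: OPT_le_if_reachable)
qed

section \<open>Randomized algorithms\<close>

lemma (in prob_space) yao_principle:
  fixes f :: "'b \<Rightarrow> 'a \<Rightarrow> real"
  assumes "finite (set_pmf p)" "\<And>x. x \<in> set_pmf p \<Longrightarrow> integrable M (f x)"
    and "\<And>\<omega>. \<omega> \<in> space M \<Longrightarrow> L \<le> measure_pmf.expectation p (\<lambda>x. f x \<omega>)"
  obtains x where "x \<in> set_pmf p" "L \<le> expectation (f x)"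
proof -
  have expectation_p: "measure_pmf.expectation p g = (\<Sum>x\<in>set_pmf p. pmf p x * g x)"
    for g :: "'b \<Rightarrow> real"
    using assms(1) by (simp add: integral_measure_pmf[of "set_pmf p"])
  have "L \<le> expectation (\<lambda>\<omega>. measure_pmf.expectation p (\<lambda>x. f x \<omega>))"
    using assms(2,3) unfolding expectation_p by (intro integral_ge_const AE_I2) auto
  also have "\<dots> = measure_pmf.expectation p (\<lambda>x. expectation (f x))"
    using assms(2) unfolding expectation_p by (simp add: Bochner_Integration.integral_sum)
  finally have average: "L \<le> measure_pmf.expectation p (\<lambda>x. expectation (f x))" .
  have "\<exists>x\<in>set_pmf p. L \<le> expectation (f x)"
  proof (rule ccontr)
    assume "\<not> ?thesis"
    then have "measure_pmf.expectation p (\<lambda>x. expectation (f x))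
        < measure_pmf.expectation p (\<lambda>_. L)"
      using assms(1) set_pmf_not_empty[of p] unfolding expectation_p
      by (intro sum_strict_mono mult_strict_left_mono) (auto simp: pmf_positive)
    with average show False by simp
  qed
  then show thesis using that by blast
qed

lemma integrable_cost:
  assumes "randomized_online_algorithm k M A" "request_sequence k \<sigma>"
  shows "integrable M (\<lambda>\<omega>. real (cost k (run (A \<omega>) \<sigma>)))"
proof -
  interpret prob_space M using assms(1) by (simp add: randomized_online_algorithm_def)
  show ?thesis
  proof (rule integrable_const_bound)
    show "AE \<omega> in M. norm (real (cost k (run (A \<omega>) \<sigma>))) \<le> real (k * length \<sigma>)"
      by (intro AE_I2) (simp add: cost_run_le del: of_nat_mult)
    show "(\<lambda>\<omega>. real (cost k (run (A \<omega>) \<sigma>))) \<in> borel_measurable M"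
      using assms by (simp add: randomized_online_algorithm_def)
  qed
qed

lemma competitive_ratio_ge_if_hard_sequences:
  assumes "a > 0"
    and hard: "\<And>n. \<exists>\<sigma>. request_sequence k \<sigma> \<and> OPT k \<sigma> \<le> m + n \<and> real n * a \<le> expected_cost k M A \<sigma>"
  shows "competitive_ratio k M A \<ge> ereal a"
proof -
  have "a \<le> c" if competitive: "competitive k M A c" for c
  proof (rule ccontr)
    assume "\<not> a \<le> c"
    define d where "d = max c 0"
    have d: "d < a" "c \<le> d" "0 \<le> d"
      using \<open>\<not> a \<le> c\<close> assms(1) by (auto simp: d_def)
    obtain b where b: "\<And>\<sigma>. request_sequence k \<sigma> \<Longrightarrow> expected_cost k M A \<sigma> \<le> c * real (OPT k \<sigma>) + b"
      using competitive unfolding competitive_def by blast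
    obtain n :: nat where n: "d * real m + b < real n * (a - d)"
      using d(1) ex_less_of_nat_mult[of "a - d"] by auto
    obtain \<sigma> where \<sigma>: "request_sequence k \<sigma>" "OPT k \<sigma> \<le> m + n" "real n * a \<le> expected_cost k M A \<sigma>"
      using hard by blast
    have "real n * a \<le> c * real (OPT k \<sigma>) + b"
      using \<sigma>(3) b[OF \<sigma>(1)] by linarith
    also have "c * real (OPT k \<sigma>) \<le> d * real (OPT k \<sigma>)"
      using d by (intro mult_right_mono) auto
    also have "\<dots> \<le> d * real (m + n)"
      using d \<sigma>(2) by (intro mult_left_mono) auto
    finally show False using n by (simp add: algebra_simps)
  qed
  then show ?thesis
    unfolding competitive_ratio_def by (intro Inf_greatest) auto
qed

lemma hard_request_sequence:
  fixes M :: "'w measure" and A :: "'w \<Rightarrow> 'p online_alg"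
  assumes "infinite (UNIV :: 'p set)" "k \<ge> 1" "randomized_online_algorithm k M A"
  obtains \<sigma> where "request_sequence k \<sigma>" "OPT k \<sigma> \<le> k + n"
    "real n * (2 * harm k - 1) \<le> expected_cost k M A \<sigma>"
proof -
  interpret prob_space M using assms(3) by (simp add: randomized_online_algorithm_def)
  obtain c :: "nat \<Rightarrow> 'p" where c: "inj c"
    using infinite_countable_subset[OF assms(1)] by auto
  define \<sigma> where "\<sigma> xss = repeat_batches k (phases c xss)" for xss
  have orders: "xss \<in> lists (permutations_of_set {1..k})" "length xss = n"
    if "xss \<in> set_pmf (random_orders k n)" for xss
    using that by (auto simp: set_replicate_pmf)
  then have valid: "request_sequence k (\<sigma> xss)" if "xss \<in> set_pmf (random_orders k n)" for xss
    using that assms(2) unfolding \<sigma>_def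
    by (intro request_sequence_repeat_batches satisfiable_phases)
  have "real n * (2 * harm k - 1)
      \<le> measure_pmf.expectation (random_orders k n) (\<lambda>xss. real (cost k (run (A \<omega>) (\<sigma> xss))))"
    if "\<omega> \<in> space M" for \<omega>
    using assms(3) that unfolding \<sigma>_def
    by (intro online_cost_lower_bound[OF c assms(2)])
      (simp add: randomized_online_algorithm_def serves_def)
  then obtain xss where xss: "xss \<in> set_pmf (random_orders k n)"
    and "real n * (2 * harm k - 1) \<le> expected_cost k M A (\<sigma> xss)"
    unfolding expected_cost_def
    using yao_principle[of "random_orders k n" "\<lambda>xss \<omega>. real (cost k (run (A \<omega>) (\<sigma> xss)))"]
      integrable_cost[OF assms(3) valid] finite_set_replicate_pmf[of "random_order {1..k}" n]
    by auto
  moreover have "OPT k (\<sigma> xss) \<le> k + n"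
    using OPT_phases_le[OF orders(1)[OF xss] assms(2), of c] orders(2)[OF xss] by (simp add: \<sigma>_def)
  ultimately show thesis using that valid by blast
qed

theorem theorem7:
  fixes k :: nat
    and M :: "'w measure"
    and A :: "'w \<Rightarrow> 'p online_alg"
  assumes "infinite (UNIV :: 'p set)"
    and "k \<ge> 1"
    and "randomized_online_algorithm k M A"
  shows "competitive_ratio k M A \<ge> ereal (2 * harm k - 1)"
proof (rule competitive_ratio_ge_if_hard_sequences)
  show "2 * harm k - 1 > (0::real)" using harm_ge_one[OF assms(2)] by simp
  show "\<exists>\<sigma>. request_sequence k \<sigma> \<and> OPT k \<sigma> \<le> k + n
      \<and> real n * (2 * harm k - 1) \<le> expected_cost k M A \<sigma>" for n
    using hard_request_sequence[OF assms] by metis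
qed

end
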